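(* Let $Q\subset\otimes_{i=1}^{l}\mathbb{R}^{d_{i}}$ and $Q_{i}\subset\mathbb{R}^{d_i}$, $i=1,\ldots,l$, be $0$-symmetric convex bodies. Then $g_Q$ is a reasonable crossnorm on $\otimes_{i=1}^{l}\left(\mathbb{R}^{d_{i}},g_{Q_i}\right)$ if and only if $$Q_{1}\otimes_{\pi}\cdots\otimes_{\pi}Q_{l}\subseteq Q\subseteq Q_{1}\otimes_{\epsilon}\cdots\otimes_{\epsilon}Q_{l}.$$ In this case, for every decomposable vector $x^{1}\otimes\cdots\otimes x^{l}\in\otimes_{i=1}^{l}\mathbb{R}^{d_{i}}$ we have $$g_{Q}\left(x^{1}\otimes\cdots\otimes x^{l}\right) = g_{Q_{1}}\left(x^{1}\right)\cdots g_{Q_{l}}\left(x^{l}\right),\qquad g_{Q^{\circ}}\left(x^{1}\otimes\cdots\otimes x^{l}\right) = g_{Q_{1}^{\circ}}\left(x^{1}\right)\cdots g_{Q_{l}^{\circ}}\left(x^{l}\right).$$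
   Context: Here $l$ and $d_1,\dots,d_l$ are positive integers. $\langle\cdot,\cdot\rangle$ is the standard scalar product on $\mathbb{R}^{d}$, and $\langle\cdot,\cdot\rangle_H$ is the scalar product on $\otimes_{i=1}^l\mathbb{R}^{d_i}$ determined by $\langle x^1\otimes\cdots\otimes x^l,y^1\otimes\cdots\otimes y^l\rangle_H=\prod_{i=1}^l\langle x^i,y^i\rangle$. In a Euclidean space $\mathbb{E}$, a convex body is a compact convex set with nonempty interior; it is $0$-symmetric if $P=-P$. The polar set of a nonempty $C\subset\mathbb{E}$ is $C^\circ=\{y\in\mathbb{E}:\sup_{x\in C}|\langle x,y\rangle_{\mathbb{E}}|\le 1\}$ (with $\langle\cdot,\cdot\rangle$ in $\mathbb{R}^{d_i}$ and $\langle\cdot,\cdot\rangle_H$ in the tensor product). The Minkowski functional of a $0$-symmetric convex body $P$ is $g_P(x)=\inf\{\lambda>0:\lambda^{-1}x\in P\}$; it is a norm with closed unit ball $P$. For $0$-symmetric convex bodies $Q_i\subset\mathbb{R}^{d_i}$: $Q_1\otimes_\pi\cdots\otimes_\pi Q_l:=\mathrm{conv}\{x^1\otimes\cdots\otimes x^l:x^i\in Q_i,\ i=1,\dots,l\}$ and $Q_1\otimes_\epsilon\cdots\otimes_\epsilon Q_l:=(Q_1^\circ\otimes_\pi\cdots\otimes_\pi Q_l^\circ)^\circ$; both are $0$-symmetric convex bodies in $\otimes_{i=1}^l\mathbb{R}^{d_i}$. A norm $\alpha$ on the tensor product $\otimes_{i=1}^l X_i$ of normed spaces is a reasonable crossnorm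 if (1) $\alpha(x^1\otimes\cdots\otimes x^l)\le\|x^1\|\cdots\|x^l\|$ for all $x^i\in X_i$, and (2) for all $x_i^*\in X_i^*$, $x_1^*\otimes\cdots\otimes x_l^*\in(\otimes_{i=1}^lX_i,\alpha)^*$ and its dual norm is at most $\|x_1^*\|\cdots\|x_l^*\|$. *)

theory Defs
  imports "HOL-Analysis.Analysis"
begin

text \<open>
  The factors of a tensor product have different dimensions, so they cannot be different types
  indexed by \<open>i\<close>. A Euclidean space is therefore represented as a coordinate subspace, with the
  inherited scalar product and topology: for \<open>J :: 'l \<Rightarrow> 'n set\<close> with nonempty values, the factor
  \<open>\<real>\<^bsup>d i\<^esup>\<close> is \<open>coord_space (J i)\<close>, where \<open>d i = card (J i)\<close>, and the number of factors is \<open>CARD('l)\<close>.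
  The tensor product of the factors consists of the arrays indexed by the
  multi-indices \<open>m :: 'l \<Rightarrow> 'n\<close> with \<open>m i \<in> J i\<close> for all \<open>i\<close>.
\<close>

definition coord_space :: "'n set \<Rightarrow> (real ^ 'n::finite) set" where
  "coord_space J = {x. \<forall>j. j \<notin> J \<longrightarrow> x $ j = 0}"

definition tensor_space :: "('l::finite \<Rightarrow> 'n::finite set) \<Rightarrow> (real ^ ('l \<Rightarrow> 'n)) set" where
  "tensor_space J = coord_space (Pi UNIV J)"

definition tensor :: "('l::finite \<Rightarrow> real ^ 'n::finite) \<Rightarrow> real ^ ('l \<Rightarrow> 'n)" where
  "tensor x = (\<chi> m. \<Prod>i\<in>UNIV. x i $ m i)"

text \<open>
  In the next definitions \<open>V\<close> is the ambient space, a linear subspace of the type. In particular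
  the interior is taken relative to \<open>V\<close>.
\<close>

definition symmetric_convex_body :: "'a::euclidean_space set \<Rightarrow> 'a set \<Rightarrow> bool" where
  "symmetric_convex_body V P \<longleftrightarrow>
     P \<subseteq> V \<and> compact P \<and> convex P \<and> top_of_set V interior_of P \<noteq> {} \<and> P = uminus ` P"

definition polar :: "'a::euclidean_space set \<Rightarrow> 'a set \<Rightarrow> 'a set" where
  "polar V C = {y \<in> V. \<forall>x\<in>C. \<bar>x \<bullet> y\<bar> \<le> 1}"

definition minkowski :: "'a::real_vector set \<Rightarrow> 'a \<Rightarrow> real" where
  "minkowski P x = Inf {c. c > 0 \<and> inverse c *\<^sub>R x \<in> P}"

definition proj_tensor :: "('l::finite \<Rightarrow> (real ^ 'n::finite) set) \<Rightarrow> (real ^ ('l \<Rightarrow> 'n)) set" where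
  "proj_tensor Q = convex hull {tensor x | x. \<forall>i. x i \<in> Q i}"

definition inj_tensor ::
  "('l::finite \<Rightarrow> 'n::finite set) \<Rightarrow> ('l \<Rightarrow> (real ^ 'n) set) \<Rightarrow> (real ^ ('l \<Rightarrow> 'n)) set" where
  "inj_tensor J Q = polar (tensor_space J) (proj_tensor (\<lambda>i. polar (coord_space (J i)) (Q i)))"

definition norm_on :: "'a::real_vector set \<Rightarrow> ('a \<Rightarrow> real) \<Rightarrow> bool" where
  "norm_on V N \<longleftrightarrow>
     (\<forall>x\<in>V. 0 \<le> N x \<and> (N x = 0 \<longleftrightarrow> x = 0)) \<and>
     (\<forall>x\<in>V. \<forall>c. N (c *\<^sub>R x) = \<bar>c\<bar> * N x) \<and>
     (\<forall>x\<in>V. \<forall>y\<in>V. N (x + y) \<le> N x + N y)"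

definition linear_functional_on :: "'a::real_vector set \<Rightarrow> ('a \<Rightarrow> real) \<Rightarrow> bool" where
  "linear_functional_on V f \<longleftrightarrow>
     (\<forall>x\<in>V. \<forall>y\<in>V. f (x + y) = f x + f y) \<and> (\<forall>x\<in>V. \<forall>c. f (c *\<^sub>R x) = c * f x)"

text \<open>
  Membership in the dual of \<open>(V, N)\<close>. Only the values of \<open>f\<close> on \<open>V\<close> matter, here and in \<open>dual_norm\<close>.
\<close>

definition in_dual :: "'a::real_vector set \<Rightarrow> ('a \<Rightarrow> real) \<Rightarrow> ('a \<Rightarrow> real) \<Rightarrow> bool" where
  "in_dual V N f \<longleftrightarrow> linear_functional_on V f \<and> (\<exists>C. \<forall>x\<in>V. \<bar>f x\<bar> \<le> C * N x)"

definition dual_norm :: "'a::real_vector set \<Rightarrow> ('a \<Rightarrow> real) \<Rightarrow> ('a \<Rightarrow> real) \<Rightarrow> real" where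
  "dual_norm V N f = (SUP x\<in>{x\<in>V. N x \<le> 1}. \<bar>f x\<bar>)"

text \<open>
  The linear functional \<open>f\<^sub>1 \<otimes> \<dots> \<otimes> f\<^sub>l\<close>, written in coordinates; on \<open>tensor_space J\<close> it is the
  linear functional determined by \<open>tensor_functional_tensor\<close> below (see \<open>span_tensor\<close>).
\<close>

definition tensor_functional ::
  "('l::finite \<Rightarrow> 'n::finite set) \<Rightarrow> ('l \<Rightarrow> real ^ 'n \<Rightarrow> real) \<Rightarrow> real ^ ('l \<Rightarrow> 'n) \<Rightarrow> real" where
  "tensor_functional J f z = (\<Sum>m\<in>Pi UNIV J. z $ m * (\<Prod>i\<in>UNIV. f i (axis (m i) 1)))"

definition reasonable_crossnorm ::
  "('l::finite \<Rightarrow> 'n::finite set) \<Rightarrow> ('l \<Rightarrow> real ^ 'n \<Rightarrow> real) \<Rightarrow> (real ^ ('l \<Rightarrow> 'n) \<Rightarrow> real) \<Rightarrow> bool"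
  where
  "reasonable_crossnorm J N \<alpha> \<longleftrightarrow>
     norm_on (tensor_space J) \<alpha> \<and>
     (\<forall>x. (\<forall>i. x i \<in> coord_space (J i)) \<longrightarrow> \<alpha> (tensor x) \<le> (\<Prod>i\<in>UNIV. N i (x i))) \<and>
     (\<forall>f. (\<forall>i. in_dual (coord_space (J i)) (N i) (f i)) \<longrightarrow>
        in_dual (tensor_space J) \<alpha> (tensor_functional J f) \<and>
        dual_norm (tensor_space J) \<alpha> (tensor_functional J f)
          \<le> (\<Prod>i\<in>UNIV. dual_norm (coord_space (J i)) (N i) (f i)))"

text \<open>
  The following facts show that \<open>tensor_space J\<close> with \<open>tensor\<close> is the tensor product of the spaces
  \<open>coord_space (J i)\<close>, that its inherited scalar product is \<open>\<langle>\<cdot>,\<cdot>\<rangle>\<^sub>H\<close>, and that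
  \<open>tensor_functional\<close> is the tensor product of functionals.
\<close>

lemma subspace_coord_space: "subspace (coord_space J)"
  by (auto simp: coord_space_def subspace_def)

lemma dim_coord_space: "dim (coord_space J) = card J"
  unfolding coord_space_def using dim_substandard_cart[of J, where 'a = real]
  by (simp add: dim_vec_eq)

lemma dim_tensor_space:
  fixes J :: "'l::finite \<Rightarrow> 'n::finite set"
  shows "dim (tensor_space J) = (\<Prod>i\<in>UNIV. dim (coord_space (J i)))"
  unfolding tensor_space_def dim_coord_space
  by (simp add: PiE_UNIV_domain[symmetric] card_PiE)

lemma inner_tensor: "tensor x \<bullet> tensor y = (\<Prod>i\<in>UNIV. x i \<bullet> y i)"
  using prod_sum_PiE[of UNIV "\<lambda>_. UNIV" "\<lambda>i j. x i $ j * y i $ j"]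
  by (simp add: inner_vec_def tensor_def prod.distrib PiE_UNIV_domain)

lemma tensor_mem:
  assumes "\<And>i. x i \<in> coord_space (J i)"
  shows "tensor x \<in> tensor_space J"
  using assms by (fastforce simp: tensor_space_def coord_space_def tensor_def Pi_def)

lemma tensor_add: "tensor (x(i := a + b)) = tensor (x(i := a)) + tensor (x(i := b))"
proof -
  have eq: "(\<Prod>k\<in>UNIV. (x(i := c)) k $ m k) = c $ m i * (\<Prod>k\<in>UNIV - {i}. x k $ m k)" for c m
    by (subst prod.remove[of _ i]) auto
  show ?thesis by (simp add: vec_eq_iff tensor_def eq distrib_right del: fun_upd_apply)
qed

lemma tensor_scaleR: "tensor (x(i := c *\<^sub>R a)) = c *\<^sub>R tensor (x(i := a))"
proof -
  have eq: "(\<Prod>k\<in>UNIV. (x(i := c)) k $ m k) = c $ m i * (\<Prod>k\<in>UNIV - {i}. x k $ m k)" for c m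
    by (subst prod.remove[of _ i]) auto
  show ?thesis by (simp add: vec_eq_iff tensor_def eq del: fun_upd_apply)
qed

lemma coord_space_expansion:
  assumes "x \<in> coord_space J"
  shows "x = (\<Sum>j\<in>J. x $ j *\<^sub>R axis j 1)"
  using assms
  by (auto simp: vec_eq_iff coord_space_def axis_def if_distrib sum.If_cases cong: if_cong)

lemma tensor_axis: "tensor (\<lambda>i. axis (m i) 1) = axis m 1"
  by (auto simp: tensor_def vec_eq_iff axis_def)

lemma span_tensor: "span {tensor x | x. \<forall>i. x i \<in> coord_space (J i)} = tensor_space J"
proof
  show "span {tensor x | x. \<forall>i. x i \<in> coord_space (J i)} \<subseteq> tensor_space J"
    by (rule span_minimal) (auto simp: tensor_mem, simp add: tensor_space_def subspace_coord_space)
  show "tensor_space J \<subseteq> span {tensor x | x. \<forall>i. x i \<in> coord_space (J i)}"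
  proof
    fix z assume "z \<in> tensor_space J"
    then have z: "z = (\<Sum>m\<in>Pi UNIV J. z $ m *\<^sub>R axis m 1)"
      unfolding tensor_space_def by (rule coord_space_expansion)
    have "axis m 1 \<in> {tensor x | x. \<forall>i. x i \<in> coord_space (J i)}" if "m \<in> Pi UNIV J" for m
      using that tensor_axis[of m]
      by (auto simp: coord_space_def axis_def Pi_def intro!: exI[of _ "\<lambda>i. axis (m i) 1"])
    then show "z \<in> span {tensor x | x. \<forall>i. x i \<in> coord_space (J i)}"
      by (subst z) (intro span_sum span_scale span_base, auto)
  qed
qed

lemma linear_tensor_functional: "linear (tensor_functional J f)"
  by (auto simp: tensor_functional_def algebra_simps sum.distrib sum_distrib_left intro!: linearI)

lemma linear_functional_on_sum:
  assumes "linear_functional_on V f" "subspace V" "\<And>j. j \<in> J \<Longrightarrow> v j \<in> V"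
  shows "f (\<Sum>j\<in>J. c j *\<^sub>R v j) = (\<Sum>j\<in>J. c j * f (v j))"
proof -
  have "f 0 = 0"
    using assms(1,2) subspace_0[of V] unfolding linear_functional_on_def
    by (metis mult_zero_left scaleR_zero_left)
  with assms(3) show ?thesis
  proof (induction J rule: infinite_finite_induct)
    case (insert j J)
    then have "c j *\<^sub>R v j \<in> V" "(\<Sum>j\<in>J. c j *\<^sub>R v j) \<in> V" "v j \<in> V"
      by (auto intro!: subspace_scale subspace_sum assms(2))
    with insert assms(1) show ?case by (simp add: linear_functional_on_def)
  qed auto
qed

lemma tensor_functional_tensor:
  assumes f: "\<And>i. linear_functional_on (coord_space (J i)) (f i)"
    and x: "\<And>i. x i \<in> coord_space (J i)"
  shows "tensor_functional J f (tensor x) = (\<Prod>i\<in>UNIV. f i (x i))"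
proof -
  have "f i (x i) = (\<Sum>j\<in>J i. x i $ j * f i (axis j 1))" for i
    by (subst coord_space_expansion[OF x[of i]],
        rule linear_functional_on_sum[OF f[of i] subspace_coord_space])
       (auto simp: coord_space_def axis_def)
  then have "(\<Prod>i\<in>UNIV. f i (x i)) = (\<Prod>i\<in>UNIV. \<Sum>j\<in>J i. x i $ j * f i (axis j 1))"
    by simp
  also have "\<dots> = (\<Sum>m\<in>Pi UNIV J. \<Prod>i\<in>UNIV. x i $ m i * f i (axis (m i) 1))"
    by (simp add: prod_sum_PiE PiE_UNIV_domain)
  finally show ?thesis
    by (simp add: tensor_functional_def tensor_def prod.distrib)
qed

end

theory Submission
  imports Defs
begin

text \<open>
  Every linear functional on a coordinate space is the scalar product with a vector, and under this
  identification \<open>f\<^sub>1 \<otimes> \<dots> \<otimes> f\<^sub>l\<close> becomes \<open>y\<^sup>1 \<otimes> \<dots> \<otimes> y\<^sup>l\<close>, while the norm dual to \<open>g\<^sub>P\<close> becomes the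
  Minkowski functional of the polar body \<open>P\<^sup>\<circ>\<close>. A reasonable crossnorm has to satisfy
  two inequalities: the cross bound \<open>g\<^sub>Q(x\<^sup>1 \<otimes> \<dots> \<otimes> x\<^sup>l) \<le> \<Prod>\<^sub>i g\<^bsub>Q\<^sub>i\<^esub>(x\<^sup>i)\<close> and its analogue for dual
  norms of functionals. The second one is therefore the cross bound for the polar bodies.

  By homogeneity, the cross bound only says that a tensor product of points of the \<open>Q\<^sub>i\<close> lies in
  \<open>Q\<close>. As \<open>Q\<close> is convex, this is the inclusion of the projective tensor product in \<open>Q\<close>
  (\<open>cross_bound_iff_proj_tensor_subset\<close>). For the polar bodies it reads
  \<open>Q\<^sub>1\<^sup>\<circ> \<otimes>\<^sub>\<pi> \<dots> \<otimes>\<^sub>\<pi> Q\<^sub>l\<^sup>\<circ> \<subseteq> Q\<^sup>\<circ>\<close>, which is the same as \<open>Q \<subseteq> Q\<^sub>1 \<otimes>\<^sub>\<epsilon> \<dots> \<otimes>\<^sub>\<epsilon> Q\<^sub>l\<close>, because polarity is an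
  antitone Galois connection.

  For the product formulas, the bipolar theorem gives \<open>g\<^sub>P(x) = max {\<bar>\<langle>x, y\<rangle>\<bar> : y \<in> P\<^sup>\<circ>}\<close>
  (\<open>minkowski_attained\<close>). Maximizers \<open>y\<^sup>i \<in> Q\<^sub>i\<^sup>\<circ>\<close> for the factors have a tensor product in \<open>Q\<^sup>\<circ>\<close>, and
  pairing it with \<open>x\<^sup>1 \<otimes> \<dots> \<otimes> x\<^sup>l\<close> gives \<open>g\<^sub>Q(x\<^sup>1 \<otimes> \<dots> \<otimes> x\<^sup>l) \<ge> \<Prod>\<^sub>i g\<^bsub>Q\<^sub>i\<^esub>(x\<^sup>i)\<close>. The formula for the
  polars is the same statement for the polar bodies, since each body is its own bipolar.
\<close>

section \<open>Polarity in a subspace\<close>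

lemma symmetric_convex_bodyD:
  assumes "symmetric_convex_body V P"
  shows "P \<subseteq> V" "compact P" "convex P" "x \<in> P \<Longrightarrow> - x \<in> P"
  using assms unfolding symmetric_convex_body_def by (blast, blast, blast, force)

text \<open>
  If \<open>x\<close> is a relative interior point, so is \<open>- x\<close>, and their midpoint \<open>0\<close> inherits a
  neighbourhood by convexity.
\<close>

lemma symmetric_convex_body_contains_ball:
  assumes V: "subspace V" and P: "symmetric_convex_body V P"
  obtains r where "r > 0" "\<And>x. x \<in> V \<Longrightarrow> norm x \<le> r \<Longrightarrow> x \<in> P"
proof -
  from P obtain a T where a: "a \<in> T" "openin (top_of_set V) T" "T \<subseteq> P"
    unfolding symmetric_convex_body_def interior_of_def by blast
  then obtain e where e: "e > 0" "ball a e \<inter> V \<subseteq> P" and aV: "a \<in> V"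
    using openin_contains_ball[of V T] by blast
  have "x \<in> P" if x: "x \<in> V" "norm x \<le> e / 4" for x
  proof -
    have "a + 2 *\<^sub>R x \<in> P"
      using e x aV V by (intro subsetD[OF e(2)]) (auto simp: dist_norm subspace_add subspace_scale)
    moreover have "- a \<in> P"
      using a symmetric_convex_bodyD(4)[OF P] by blast
    ultimately have "(1/2) *\<^sub>R (a + 2 *\<^sub>R x) + (1/2) *\<^sub>R (- a) \<in> P"
      using symmetric_convex_bodyD(3)[OF P] by (intro convexD) auto
    then show ?thesis by (simp add: algebra_simps)
  qed
  with e(1) that[of "e / 4"] show ?thesis by simp
qed

lemma symmetric_convex_body_zero:
  assumes "subspace V" "symmetric_convex_body V P"
  shows "0 \<in> P"
  using symmetric_convex_body_contains_ball[OF assms] subspace_0[OF assms(1)]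
  by (metis less_imp_le norm_zero)

lemma symmetric_convex_body_polar:
  assumes V: "subspace V" and P: "symmetric_convex_body V P"
  shows "symmetric_convex_body V (polar V P)"
  unfolding symmetric_convex_body_def
proof (intro conjI)
  show sub: "polar V P \<subseteq> V" by (auto simp: polar_def)
  have polar_eq: "polar V P = V \<inter> (\<Inter>x\<in>P. {y. x \<bullet> y \<le> 1} \<inter> {y. x \<bullet> y \<ge> -1})"
    by (auto simp: polar_def abs_le_iff)
  show "convex (polar V P)"
    unfolding polar_eq
    by (intro convex_Int convex_INT subspace_imp_convex V convex_halfspace_le convex_halfspace_ge)
  obtain r where r: "r > 0" "\<And>x. x \<in> V \<Longrightarrow> norm x \<le> r \<Longrightarrow> x \<in> P"
    using symmetric_convex_body_contains_ball[OF V P] by blast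
  have "norm y \<le> 1 / r" if y: "y \<in> polar V P" for y
  proof (cases "y = 0")
    case False
    \<comment> \<open>The point of length \<open>r\<close> in the direction of \<open>y\<close> belongs to \<open>P\<close>.\<close>
    have "(r / norm y) *\<^sub>R y \<in> P"
      using r False y sub V by (intro r(2)) (auto intro!: subspace_scale)
    then have "\<bar>((r / norm y) *\<^sub>R y) \<bullet> y\<bar> \<le> 1" using y by (auto simp: polar_def)
    moreover have "((r / norm y) *\<^sub>R y) \<bullet> y = r * norm y"
      using False by (simp add: dot_square_norm power2_eq_square)
    ultimately show ?thesis using r(1) by (simp add: field_simps)
  qed (use r in simp)
  then have "bounded (polar V P)" by (auto simp: bounded_iff)
  moreover have "closed (polar V P)"
    unfolding polar_eq
    by (intro closed_Int closed_INT ballI closed_subspace V closed_halfspace_le closed_halfspace_ge)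
  ultimately show "compact (polar V P)" by (simp add: compact_eq_bounded_closed)
  obtain R where R: "R > 0" "\<And>x. x \<in> P \<Longrightarrow> norm x \<le> R"
    using compact_imp_bounded[OF symmetric_convex_bodyD(2)[OF P]] by (auto simp: bounded_pos)
  have "ball 0 (1 / R) \<inter> V \<subseteq> polar V P"
  proof
    fix y assume y: "y \<in> ball 0 (1 / R) \<inter> V"
    have "\<bar>x \<bullet> y\<bar> \<le> 1" if "x \<in> P" for x
    proof -
      have "\<bar>x \<bullet> y\<bar> \<le> norm x * norm y" by (rule Cauchy_Schwarz_ineq2)
      also have "\<dots> \<le> R * (1 / R)" using y R(1) R(2)[OF that] by (intro mult_mono) auto
      finally show ?thesis using R(1) by simp
    qed
    then show "y \<in> polar V P" using y by (auto simp: polar_def)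
  qed
  moreover have "openin (top_of_set V) (ball 0 (1 / R) \<inter> V)"
    by (metis inf_commute open_ball openin_open_Int)
  moreover have "0 \<in> ball 0 (1 / R) \<inter> V"
    using R(1) subspace_0[OF V] by simp
  ultimately show "top_of_set V interior_of polar V P \<noteq> {}"
    unfolding interior_of_def by blast
  have neg: "- y \<in> polar V P" if "y \<in> polar V P" for y
    using that V by (auto simp: polar_def subspace_neg)
  show "polar V P = uminus ` polar V P"
    using neg by (auto simp: image_iff) (metis minus_minus neg)
qed

text \<open>
  A point of \<open>V\<close> outside \<open>P\<close> is strictly separated from \<open>P\<close> by a vector of the whole type. Its
  orthogonal projection to \<open>V\<close> separates equally well, and after scaling it belongs to the polar.
\<close>

lemma bipolar:
  assumes V: "subspace V" and P: "symmetric_convex_body V P"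
  shows "polar V (polar V P) = P"
proof
  show "P \<subseteq> polar V (polar V P)"
    using symmetric_convex_bodyD(1)[OF P] by (auto simp: polar_def inner_commute)
  show "polar V (polar V P) \<subseteq> P"
  proof
    fix z assume z: "z \<in> polar V (polar V P)"
    show "z \<in> P"
    proof (rule ccontr)
      assume "z \<notin> P"
      then obtain a b where sep: "a \<bullet> z < b" "\<And>x. x \<in> P \<Longrightarrow> b < a \<bullet> x"
        using separating_hyperplane_closed_point[of P z] symmetric_convex_bodyD(2,3)[OF P]
        by (metis compact_imp_closed)
      have b: "b < 0" using sep(2)[OF symmetric_convex_body_zero[OF V P]] by simp
      obtain a' w where a': "a' \<in> V" "\<And>v. v \<in> V \<Longrightarrow> orthogonal w v" "a = a' + w"
        using orthogonal_subspace_decomp_exists[of V a] by (metis V span_eq_iff)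
      have inner: "a \<bullet> x = a' \<bullet> x" if "x \<in> V" for x
        using a'(2)[OF that] a'(3) by (simp add: inner_add_left orthogonal_def)
      have "\<bar>x \<bullet> ((1 / b) *\<^sub>R a')\<bar> \<le> 1" if "x \<in> P" for x
      proof -
        have "x \<in> V" "- x \<in> P" using that symmetric_convex_bodyD[OF P] by auto
        then have "b < a' \<bullet> x" "b < - (a' \<bullet> x)"
          using sep(2)[OF that] sep(2)[of "- x"] inner[of x] by auto
        then have "\<bar>a' \<bullet> x\<bar> \<le> - b" by linarith
        then show ?thesis using b by (simp add: inner_commute abs_divide field_simps)
      qed
      then have "(1 / b) *\<^sub>R a' \<in> polar V P"
        using a'(1) V by (auto simp: polar_def subspace_scale)
      then have "\<bar>((1 / b) *\<^sub>R a') \<bullet> z\<bar> \<le> 1" and zV: "z \<in> V"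
        using z by (auto simp: polar_def)
      then have "\<bar>a' \<bullet> z\<bar> \<le> - b" using b by (simp add: abs_divide field_simps)
      with sep(1) inner[OF zV] show False by linarith
    qed
  qed
qed

lemma subset_polar_iff:
  assumes "C \<subseteq> V" "D \<subseteq> V"
  shows "C \<subseteq> polar V D \<longleftrightarrow> D \<subseteq> polar V C"
  using assms unfolding polar_def by (auto simp: subset_iff) (metis inner_commute)+

section \<open>The Minkowski functional as a maximum over the polar body\<close>

text \<open>
  By the bipolar theorem, \<open>\<lambda>\<^sup>-\<^sup>1 x \<in> P\<close> means that \<open>\<bar>\<langle>x, y\<rangle>\<bar> \<le> \<lambda>\<close> for all \<open>y \<in> P\<^sup>\<circ>\<close>. So the infimum
  of these \<open>\<lambda>\<close> is the maximum of \<open>\<bar>\<langle>x, y\<rangle>\<bar>\<close>, which exists by compactness. The norm axioms and the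
  duality of norms all follow from this description.
\<close>

lemma minkowski_attained:
  assumes V: "subspace V" and P: "symmetric_convex_body V P" and x: "x \<in> V"
  obtains y where "y \<in> polar V P" "\<bar>x \<bullet> y\<bar> = minkowski P x"
    "\<And>z. z \<in> polar V P \<Longrightarrow> \<bar>x \<bullet> z\<bar> \<le> minkowski P x"
proof -
  note P' = symmetric_convex_body_polar[OF V P]
  have "polar V P \<noteq> {}" using symmetric_convex_body_zero[OF V P'] by blast
  moreover have "continuous_on (polar V P) (\<lambda>y. \<bar>x \<bullet> y\<bar>)" by (intro continuous_intros)
  ultimately obtain y where y: "y \<in> polar V P" "\<And>z. z \<in> polar V P \<Longrightarrow> \<bar>x \<bullet> z\<bar> \<le> \<bar>x \<bullet> y\<bar>"
    using continuous_attains_sup[OF symmetric_convex_bodyD(2)[OF P']] by blast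
  have "inverse c *\<^sub>R x \<in> P \<longleftrightarrow> \<bar>x \<bullet> y\<bar> \<le> c" if c: "c > 0" for c
  proof -
    have "inverse c *\<^sub>R x \<in> P \<longleftrightarrow> inverse c *\<^sub>R x \<in> polar V (polar V P)"
      by (simp add: bipolar[OF V P])
    also have "\<dots> \<longleftrightarrow> (\<forall>z\<in>polar V P. \<bar>z \<bullet> (inverse c *\<^sub>R x)\<bar> \<le> 1)"
      unfolding polar_def[of V "polar V P"] using x V by (simp add: subspace_scale)
    also have "\<dots> \<longleftrightarrow> (\<forall>z\<in>polar V P. \<bar>x \<bullet> z\<bar> \<le> c)"
      using c by (simp add: abs_mult inner_commute field_simps)
    also have "\<dots> \<longleftrightarrow> \<bar>x \<bullet> y\<bar> \<le> c" using y by force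
    finally show ?thesis .
  qed
  then have eq: "{c. c > 0 \<and> inverse c *\<^sub>R x \<in> P} = {c. c > 0 \<and> \<bar>x \<bullet> y\<bar> \<le> c}" by blast
  have "Inf {c. c > 0 \<and> \<bar>x \<bullet> y\<bar> \<le> c} = \<bar>x \<bullet> y\<bar>"
  proof (cases "x \<bullet> y = 0")
    case True
    \<comment> \<open>Here the infimum is not attained, because \<open>0\<close> is excluded from the set.\<close>
    then have "{c. c > 0 \<and> \<bar>x \<bullet> y\<bar> \<le> c} = {0<..}" by auto
    then show ?thesis using True by simp
  next
    case False
    then have "{c. c > 0 \<and> \<bar>x \<bullet> y\<bar> \<le> c} = {\<bar>x \<bullet> y\<bar>..}" by auto
    then show ?thesis by simp
  qed
  then have "minkowski P x = \<bar>x \<bullet> y\<bar>" by (simp add: minkowski_def eq)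
  with y that show ?thesis by metis
qed

lemma inner_le_minkowski:
  assumes "subspace V" "symmetric_convex_body V P" "x \<in> V" "y \<in> polar V P"
  shows "\<bar>x \<bullet> y\<bar> \<le> minkowski P x"
  using minkowski_attained[OF assms(1-3)] assms(4) by metis

lemma minkowski_nonneg:
  assumes "subspace V" "symmetric_convex_body V P" "x \<in> V"
  shows "0 \<le> minkowski P x"
  using minkowski_attained[OF assms] abs_ge_zero by metis

lemma minkowski_le_iff:
  assumes "subspace V" "symmetric_convex_body V P" "x \<in> V"
  shows "minkowski P x \<le> c \<longleftrightarrow> (\<forall>y\<in>polar V P. \<bar>x \<bullet> y\<bar> \<le> c)"
  using minkowski_attained[OF assms] by (metis order_trans)

lemma minkowski_le_1_iff:
  assumes "subspace V" "symmetric_convex_body V P" "x \<in> V"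
  shows "minkowski P x \<le> 1 \<longleftrightarrow> x \<in> P"
proof -
  have "minkowski P x \<le> 1 \<longleftrightarrow> x \<in> polar V (polar V P)"
    using assms(3) by (auto simp: minkowski_le_iff[OF assms] polar_def[of V "polar V P"] inner_commute)
  then show ?thesis by (simp add: bipolar[OF assms(1,2)])
qed

lemma minkowski_scaleR:
  assumes "subspace V" "symmetric_convex_body V P" "x \<in> V"
  shows "minkowski P (c *\<^sub>R x) = \<bar>c\<bar> * minkowski P x"
proof (rule antisym)
  have cx: "c *\<^sub>R x \<in> V" using assms by (simp add: subspace_scale)
  show "minkowski P (c *\<^sub>R x) \<le> \<bar>c\<bar> * minkowski P x"
    using inner_le_minkowski[OF assms]
    by (auto simp: minkowski_le_iff[OF assms(1,2) cx] abs_mult intro!: mult_left_mono)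
  obtain y where y: "y \<in> polar V P" "\<bar>x \<bullet> y\<bar> = minkowski P x"
    using minkowski_attained[OF assms] .
  show "\<bar>c\<bar> * minkowski P x \<le> minkowski P (c *\<^sub>R x)"
    using inner_le_minkowski[OF assms(1,2) cx y(1)] y(2) by (simp add: abs_mult)
qed

lemma norm_on_minkowski:
  assumes V: "subspace V" and P: "symmetric_convex_body V P"
  shows "norm_on V (minkowski P)"
  unfolding norm_on_def
proof (intro conjI ballI allI)
  fix x y assume x: "x \<in> V" and y: "y \<in> V"
  have "\<bar>(x + y) \<bullet> z\<bar> \<le> minkowski P x + minkowski P y" if "z \<in> polar V P" for z
    using inner_le_minkowski[OF V P x that] inner_le_minkowski[OF V P y that]
    by (simp add: inner_add_left)
  then show "minkowski P (x + y) \<le> minkowski P x + minkowski P y"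
    using minkowski_le_iff[OF V P subspace_add[OF V x y]] by blast
next
  fix x assume x: "x \<in> V"
  show "minkowski P x = 0 \<longleftrightarrow> x = 0"
  proof
    assume 0: "minkowski P x = 0"
    obtain r where r: "r > 0" "\<And>z. z \<in> V \<Longrightarrow> norm z \<le> r \<Longrightarrow> z \<in> polar V P"
      using symmetric_convex_body_contains_ball[OF V symmetric_convex_body_polar[OF V P]] by blast
    show "x = 0"
    proof (rule ccontr)
      assume "x \<noteq> 0"
      then have rx: "(r / norm x) *\<^sub>R x \<in> polar V P"
        using r(1) x V by (intro r(2)) (auto simp: subspace_scale)
      have "\<bar>x \<bullet> ((r / norm x) *\<^sub>R x)\<bar> \<le> 0"
        using inner_le_minkowski[OF V P x rx] unfolding 0 .
      then have "x \<bullet> ((r / norm x) *\<^sub>R x) = 0" by (simp only: abs_le_zero_iff)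
      with r(1) \<open>x \<noteq> 0\<close> show False by simp
    qed
  qed (use minkowski_scaleR[OF V P x, of 0] in simp)
qed (use minkowski_nonneg[OF V P] minkowski_scaleR[OF V P] in auto)

lemma minkowski_eq_0_iff:
  assumes "subspace V" "symmetric_convex_body V P" "x \<in> V"
  shows "minkowski P x = 0 \<longleftrightarrow> x = 0"
  using norm_on_minkowski[OF assms(1,2)] assms(3) by (simp add: norm_on_def)

section \<open>Duality\<close>

lemma in_dual_inner:
  assumes V: "subspace V" and P: "symmetric_convex_body V P" and y: "y \<in> V"
    and f: "\<And>x. x \<in> V \<Longrightarrow> f x = x \<bullet> y"
  shows "in_dual V (minkowski P) f"
  unfolding in_dual_def
proof
  show "linear_functional_on V f"
    using V by (simp add: linear_functional_on_def f inner_add_left subspace_add subspace_scale)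
  obtain r where r: "r > 0" "\<And>z. z \<in> V \<Longrightarrow> norm z \<le> r \<Longrightarrow> z \<in> polar V P"
    using symmetric_convex_body_contains_ball[OF V symmetric_convex_body_polar[OF V P]] by blast
  \<comment> \<open>A small positive multiple \<open>e y\<close> lies in the polar body, so \<open>e \<bar>\<langle>x, y\<rangle>\<bar> \<le> g\<^sub>P(x)\<close>.\<close>
  define e where "e = r / (norm y + 1)"
  have e: "e > 0" using r(1) by (simp add: e_def add_nonneg_pos)
  have "e * norm y \<le> e * (norm y + 1)" using e by simp
  also have "\<dots> = r" using norm_ge_zero[of y] by (simp add: e_def del: norm_ge_zero)
  finally have "norm (e *\<^sub>R y) \<le> r" using e by simp
  then have ey: "e *\<^sub>R y \<in> polar V P" using y V r(2) by (simp add: subspace_scale)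
  have "\<bar>f x\<bar> \<le> (1 / e) * minkowski P x" if x: "x \<in> V" for x
    using inner_le_minkowski[OF V P x ey] e by (simp add: f[OF x] abs_mult field_simps)
  then show "\<exists>C. \<forall>x\<in>V. \<bar>f x\<bar> \<le> C * minkowski P x" by blast
qed

text \<open>
  The dual norm of \<open>\<langle>\<cdot>, y\<rangle>\<close> is the supremum of \<open>\<bar>\<langle>x, y\<rangle>\<bar>\<close> over \<open>x \<in> P = P\<^sup>\<circ>\<^sup>\<circ>\<close>, so this is
  \<open>minkowski_attained\<close> for the body \<open>P\<^sup>\<circ>\<close>.
\<close>

lemma dual_norm_inner:
  assumes V: "subspace V" and P: "symmetric_convex_body V P" and y: "y \<in> V"
    and f: "\<And>x. x \<in> V \<Longrightarrow> f x = x \<bullet> y"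
  shows "dual_norm V (minkowski P) f = minkowski (polar V P) y"
proof -
  have ball: "{x \<in> V. minkowski P x \<le> 1} = P"
    using minkowski_le_1_iff[OF V P] symmetric_convex_bodyD(1)[OF P] by blast
  obtain x where x: "x \<in> P" "\<bar>x \<bullet> y\<bar> = minkowski (polar V P) y"
    "\<And>z. z \<in> P \<Longrightarrow> \<bar>z \<bullet> y\<bar> \<le> minkowski (polar V P) y"
    using minkowski_attained[OF V symmetric_convex_body_polar[OF V P] y]
    by (metis bipolar[OF V P] inner_commute)
  have fP: "f z = z \<bullet> y" if "z \<in> P" for z
    using that symmetric_convex_bodyD(1)[OF P] f by blast
  show ?thesis
    unfolding dual_norm_def ball
    by (rule cSup_eq_maximum) (use x fP in force)+
qed

lemma linear_functional_on_coord_space_eq_inner: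
  assumes "linear_functional_on (coord_space J) f" and x: "x \<in> coord_space J"
  shows "f x = x \<bullet> (\<chi> j. if j \<in> J then f (axis j 1) else 0)"
proof -
  have "f x = (\<Sum>j\<in>J. x $ j * f (axis j 1))"
    by (subst coord_space_expansion[OF x],
        rule linear_functional_on_sum[OF assms(1) subspace_coord_space])
       (auto simp: coord_space_def axis_def)
  also have "\<dots> = x \<bullet> (\<chi> j. if j \<in> J then f (axis j 1) else 0)"
    by (simp add: inner_vec_def if_distrib sum.If_cases cong: if_cong)
  finally show ?thesis .
qed

text \<open>
  A tensor product of functionals is thus represented by a decomposable vector, and its dual norm
  can be computed by \<open>dual_norm_inner\<close> in the tensor space.
\<close>

lemma tensor_functional_eq_inner:
  assumes y: "\<And>i. y i \<in> coord_space (J i)"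
    and f: "\<And>i x. x \<in> coord_space (J i) \<Longrightarrow> f i x = x \<bullet> y i"
  shows "tensor_functional J f z = z \<bullet> tensor y"
proof -
  have "f i (axis j 1) = y i $ j" if "j \<in> J i" for i j
  proof -
    have "axis j 1 \<in> coord_space (J i)" using that by (auto simp: coord_space_def axis_def)
    then show ?thesis using f by (simp add: inner_axis')
  qed
  then have "tensor_functional J f z = (\<Sum>m\<in>Pi UNIV J. z $ m * tensor y $ m)"
    by (auto simp: tensor_functional_def tensor_def Pi_def intro!: sum.cong prod.cong)
  also have "\<dots> = z \<bullet> tensor y"
    unfolding inner_vec_def inner_real_def
    using tensor_mem[of y J, OF y]
    by (intro sum.mono_neutral_left) (auto simp: tensor_space_def coord_space_def)
  finally show ?thesis .
qed

section \<open>Crossnorms and tensor products of convex bodies\<close>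

lemma tensor_scaleR_all: "tensor (\<lambda>i. c i *\<^sub>R x i) = (\<Prod>i\<in>UNIV. c i) *\<^sub>R tensor x"
  by (simp add: tensor_def vec_eq_iff prod.distrib)

lemma tensor_zero_factor: "x i = 0 \<Longrightarrow> tensor x = 0"
  by (auto simp: tensor_def vec_eq_iff)

lemma subspace_tensor_space: "subspace (tensor_space J)"
  by (simp add: tensor_space_def subspace_coord_space)

lemma proj_tensor_subset_tensor_space:
  assumes "\<And>i. Qs i \<subseteq> coord_space (J i)"
  shows "proj_tensor Qs \<subseteq> tensor_space J"
  unfolding proj_tensor_def
  by (rule hull_minimal)
     (use assms tensor_mem in \<open>blast, simp add: subspace_imp_convex subspace_tensor_space\<close>)

lemma tensor_mem_proj_tensor: "(\<And>i. x i \<in> Qs i) \<Longrightarrow> tensor x \<in> proj_tensor Qs"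
  unfolding proj_tensor_def by (rule hull_inc) blast

text \<open>
  On points of the bodies \<open>Qs i\<close> the right-hand side is at most \<open>1\<close>, so the bound places their tensor
  product in \<open>Q\<close>. Conversely, nonzero factors can be scaled to have Minkowski functional \<open>1\<close>, and
  both sides of the bound are homogeneous in each factor.
\<close>

lemma cross_bound_iff_proj_tensor_subset:
  assumes Q: "symmetric_convex_body (tensor_space J) Q"
    and Qs: "\<And>i. symmetric_convex_body (coord_space (J i)) (Qs i)"
  shows "(\<forall>x. (\<forall>i. x i \<in> coord_space (J i)) \<longrightarrow>
            minkowski Q (tensor x) \<le> (\<Prod>i\<in>UNIV. minkowski (Qs i) (x i))) \<longleftrightarrow>
         proj_tensor Qs \<subseteq> Q"
    (is "?bound \<longleftrightarrow> _")
proof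
  note T = subspace_tensor_space[of J]
  assume b: ?bound
  have "tensor x \<in> Q" if x: "\<And>i. x i \<in> Qs i" for x
  proof -
    have xV: "x i \<in> coord_space (J i)" for i
      using x symmetric_convex_bodyD(1)[OF Qs] by blast
    have "minkowski Q (tensor x) \<le> (\<Prod>i\<in>UNIV. minkowski (Qs i) (x i))"
      using b xV by blast
    also have "\<dots> \<le> 1"
      using minkowski_le_1_iff[OF subspace_coord_space Qs xV] x
        minkowski_nonneg[OF subspace_coord_space Qs xV]
      by (intro prod_le_1) auto
    finally show ?thesis
      using minkowski_le_1_iff[OF T Q tensor_mem[of x J, OF xV]] by blast
  qed
  then show "proj_tensor Qs \<subseteq> Q"
    unfolding proj_tensor_def
    by (intro hull_minimal) (use symmetric_convex_bodyD(3)[OF Q] in auto)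
next
  note T = subspace_tensor_space[of J]
  assume sub: "proj_tensor Qs \<subseteq> Q"
  show ?bound
  proof (intro allI impI)
    fix x assume xV: "\<forall>i. x i \<in> coord_space (J i)"
    define g where "g i = minkowski (Qs i) (x i)" for i
    have g0: "0 \<le> g i" for i
      using minkowski_nonneg[OF subspace_coord_space Qs] xV by (simp add: g_def)
    have "minkowski Q (tensor x) \<le> (\<Prod>i\<in>UNIV. g i)"
    proof (cases "\<exists>i. x i = 0")
      case True
      then have "tensor x = 0" using tensor_zero_factor by blast
      then have "minkowski Q (tensor x) = 0"
        using minkowski_eq_0_iff[OF T Q] subspace_0[OF T] by metis
      then show ?thesis by (simp add: prod_nonneg g0)
    next
      case False
      then have pos: "0 < g i" for i
        using g0[of i] minkowski_eq_0_iff[OF subspace_coord_space Qs, of "x i" i] xV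
        by (auto simp: g_def less_le)
      define u where "u i = inverse (g i) *\<^sub>R x i" for i
      have uV: "u i \<in> coord_space (J i)" for i
        using xV by (simp add: u_def subspace_scale subspace_coord_space)
      have "minkowski (Qs i) (u i) = 1" for i
        using minkowski_scaleR[OF subspace_coord_space Qs, of "x i" i "inverse (g i)"] xV pos[of i]
        by (simp add: u_def g_def[symmetric])
      then have "u i \<in> Qs i" for i
        using minkowski_le_1_iff[OF subspace_coord_space Qs uV] by simp
      then have "tensor u \<in> Q" using sub tensor_mem_proj_tensor by blast
      then have u1: "minkowski Q (tensor u) \<le> 1"
        using minkowski_le_1_iff[OF T Q tensor_mem[of u J, OF uV]] by blast
      have "x i = g i *\<^sub>R u i" for i
        using pos[of i] by (simp add: u_def)
      then have "tensor x = (\<Prod>i\<in>UNIV. g i) *\<^sub>R tensor u"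
        using tensor_scaleR_all[of g u] by (metis ext)
      then have "minkowski Q (tensor x) = (\<Prod>i\<in>UNIV. g i) * minkowski Q (tensor u)"
        using minkowski_scaleR[OF T Q tensor_mem[of u J, OF uV]] by (simp add: prod_nonneg g0)
      also have "\<dots> \<le> (\<Prod>i\<in>UNIV. g i)"
        using u1 by (simp add: mult_left_le prod_nonneg g0)
      finally show ?thesis .
    qed
    then show "minkowski Q (tensor x) \<le> (\<Prod>i\<in>UNIV. minkowski (Qs i) (x i))"
      by (simp add: g_def)
  qed
qed

text \<open>
  The first inclusion gives \<open>\<le>\<close>. For \<open>\<ge>\<close>, tensor together points of the polars of the factors
  that are extremal for the \<open>x i\<close>: by the second inclusion they give a competitor in the maximum
  that defines \<open>minkowski Q (tensor x)\<close>.
\<close>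

lemma minkowski_tensor:
  assumes Q: "symmetric_convex_body (tensor_space J) Q"
    and Qs: "\<And>i. symmetric_convex_body (coord_space (J i)) (Qs i)"
    and sub: "proj_tensor Qs \<subseteq> Q"
    and polar_sub: "proj_tensor (\<lambda>i. polar (coord_space (J i)) (Qs i)) \<subseteq> polar (tensor_space J) Q"
    and x: "\<And>i. x i \<in> coord_space (J i)"
  shows "minkowski Q (tensor x) = (\<Prod>i\<in>UNIV. minkowski (Qs i) (x i))"
proof (rule antisym)
  show "minkowski Q (tensor x) \<le> (\<Prod>i\<in>UNIV. minkowski (Qs i) (x i))"
    using cross_bound_iff_proj_tensor_subset[OF Q Qs] sub x by blast
  have "\<exists>y. y \<in> polar (coord_space (J i)) (Qs i) \<and> \<bar>x i \<bullet> y\<bar> = minkowski (Qs i) (x i)" for i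
    using minkowski_attained[OF subspace_coord_space Qs x] by metis
  then obtain y where y: "\<And>i. y i \<in> polar (coord_space (J i)) (Qs i)"
      "\<And>i. \<bar>x i \<bullet> y i\<bar> = minkowski (Qs i) (x i)"
    by metis
  have "tensor y \<in> polar (tensor_space J) Q"
    using polar_sub tensor_mem_proj_tensor[of y "\<lambda>i. polar (coord_space (J i)) (Qs i)"] y(1)
    by blast
  then have "\<bar>tensor x \<bullet> tensor y\<bar> \<le> minkowski Q (tensor x)"
    by (rule inner_le_minkowski[OF subspace_tensor_space Q tensor_mem[of x J, OF x]])
  then show "(\<Prod>i\<in>UNIV. minkowski (Qs i) (x i)) \<le> minkowski Q (tensor x)"
    by (simp add: inner_tensor abs_prod y(2))
qed

text \<open>
  Representing functionals by vectors turns the bound on dual norms into the cross bound for the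
  polar bodies, which is again an inclusion.
\<close>

lemma reasonable_crossnorm_minkowski_iff:
  assumes Q: "symmetric_convex_body (tensor_space J) Q"
    and Qs: "\<And>i. symmetric_convex_body (coord_space (J i)) (Qs i)"
  shows "reasonable_crossnorm J (\<lambda>i. minkowski (Qs i)) (minkowski Q) \<longleftrightarrow>
         proj_tensor Qs \<subseteq> Q \<and>
         proj_tensor (\<lambda>i. polar (coord_space (J i)) (Qs i)) \<subseteq> polar (tensor_space J) Q"
proof -
  note T = subspace_tensor_space[of J]
  let ?polar_bound = "\<forall>y. (\<forall>i. y i \<in> coord_space (J i)) \<longrightarrow>
      minkowski (polar (tensor_space J) Q) (tensor y) \<le>
        (\<Prod>i\<in>UNIV. minkowski (polar (coord_space (J i)) (Qs i)) (y i))"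
  have functional:
    "in_dual (tensor_space J) (minkowski Q) (tensor_functional J f) \<and>
     dual_norm (tensor_space J) (minkowski Q) (tensor_functional J f) =
       minkowski (polar (tensor_space J) Q) (tensor y) \<and>
     (\<forall>i. dual_norm (coord_space (J i)) (minkowski (Qs i)) (f i) =
       minkowski (polar (coord_space (J i)) (Qs i)) (y i))"
    if y: "\<And>i. y i \<in> coord_space (J i)"
      and f: "\<And>i x. x \<in> coord_space (J i) \<Longrightarrow> f i x = x \<bullet> y i" for f y
    using in_dual_inner[OF T Q tensor_mem[of y J, OF y] tensor_functional_eq_inner[OF y f]]
      dual_norm_inner[OF T Q tensor_mem[of y J, OF y] tensor_functional_eq_inner[OF y f]]
      dual_norm_inner[OF subspace_coord_space Qs y f]
    by blast
  have "(\<forall>f. (\<forall>i. in_dual (coord_space (J i)) (minkowski (Qs i)) (f i)) \<longrightarrow>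
          in_dual (tensor_space J) (minkowski Q) (tensor_functional J f) \<and>
          dual_norm (tensor_space J) (minkowski Q) (tensor_functional J f)
            \<le> (\<Prod>i\<in>UNIV. dual_norm (coord_space (J i)) (minkowski (Qs i)) (f i)))
        \<longleftrightarrow> ?polar_bound" (is "?functional_bound \<longleftrightarrow> _")
  proof
    assume b: ?functional_bound
    show ?polar_bound
    proof (intro allI impI)
      fix y assume y: "\<forall>i. y i \<in> coord_space (J i)"
      define f where "f i x = x \<bullet> y i" for i and x :: "real ^ 'b"
      have "\<forall>i. in_dual (coord_space (J i)) (minkowski (Qs i)) (f i)"
        using y by (auto simp: f_def intro!: in_dual_inner[OF subspace_coord_space Qs])
      with b have "dual_norm (tensor_space J) (minkowski Q) (tensor_functional J f)
          \<le> (\<Prod>i\<in>UNIV. dual_norm (coord_space (J i)) (minkowski (Qs i)) (f i))" by blast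
      then show "minkowski (polar (tensor_space J) Q) (tensor y) \<le>
          (\<Prod>i\<in>UNIV. minkowski (polar (coord_space (J i)) (Qs i)) (y i))"
        using functional[of y f] y by (simp add: f_def)
    qed
  next
    assume b: ?polar_bound
    show ?functional_bound
    proof (intro allI impI)
      fix f assume f: "\<forall>i. in_dual (coord_space (J i)) (minkowski (Qs i)) (f i)"
      define y :: "'a \<Rightarrow> real ^ 'b" where "y i = (\<chi> j. if j \<in> J i then f i (axis j 1) else 0)" for i
      have y: "y i \<in> coord_space (J i)" for i by (simp add: y_def coord_space_def)
      have "f i x = x \<bullet> y i" if "x \<in> coord_space (J i)" for i x
        using f linear_functional_on_coord_space_eq_inner[of "J i" "f i" x] that
        by (simp add: in_dual_def y_def)
      from functional[of y f, OF y this] b y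
      show "in_dual (tensor_space J) (minkowski Q) (tensor_functional J f) \<and>
          dual_norm (tensor_space J) (minkowski Q) (tensor_functional J f)
            \<le> (\<Prod>i\<in>UNIV. dual_norm (coord_space (J i)) (minkowski (Qs i)) (f i))"
        by simp
    qed
  qed
  then show ?thesis
    unfolding reasonable_crossnorm_def
    using norm_on_minkowski[OF T Q] cross_bound_iff_proj_tensor_subset[OF Q Qs]
      cross_bound_iff_proj_tensor_subset[OF symmetric_convex_body_polar[OF T Q]
        symmetric_convex_body_polar[OF subspace_coord_space Qs]]
    by simp
qed

theorem proposition3p1:
  fixes J :: "'l::finite \<Rightarrow> 'n::finite set"
    and Q :: "(real ^ ('l \<Rightarrow> 'n)) set"
    and Qs :: "'l \<Rightarrow> (real ^ 'n) set"
  assumes "\<And>i. J i \<noteq> {}"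
    and "symmetric_convex_body (tensor_space J) Q"
    and "\<And>i. symmetric_convex_body (coord_space (J i)) (Qs i)"
  shows "(reasonable_crossnorm J (\<lambda>i. minkowski (Qs i)) (minkowski Q) \<longleftrightarrow>
           proj_tensor Qs \<subseteq> Q \<and> Q \<subseteq> inj_tensor J Qs) \<and>
         (reasonable_crossnorm J (\<lambda>i. minkowski (Qs i)) (minkowski Q) \<longrightarrow>
           (\<forall>x. (\<forall>i. x i \<in> coord_space (J i)) \<longrightarrow>
             minkowski Q (tensor x) = (\<Prod>i\<in>UNIV. minkowski (Qs i) (x i)) \<and>
             minkowski (polar (tensor_space J) Q) (tensor x) =
               (\<Prod>i\<in>UNIV. minkowski (polar (coord_space (J i)) (Qs i)) (x i))))"
proof -
  note Q = assms(2) and Qs = assms(3)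
  note T = subspace_tensor_space[of J]
  note Q' = symmetric_convex_body_polar[OF T Q]
  note Qs' = symmetric_convex_body_polar[OF subspace_coord_space Qs]
  have inj: "Q \<subseteq> inj_tensor J Qs \<longleftrightarrow>
      proj_tensor (\<lambda>i. polar (coord_space (J i)) (Qs i)) \<subseteq> polar (tensor_space J) Q"
    unfolding inj_tensor_def
    using symmetric_convex_bodyD(1)[OF Q]
      proj_tensor_subset_tensor_space[OF symmetric_convex_bodyD(1)[OF Qs']]
    by (rule subset_polar_iff)
  have "minkowski (polar (tensor_space J) Q) (tensor x) =
      (\<Prod>i\<in>UNIV. minkowski (polar (coord_space (J i)) (Qs i)) (x i))"
    if "proj_tensor Qs \<subseteq> Q"
      "proj_tensor (\<lambda>i. polar (coord_space (J i)) (Qs i)) \<subseteq> polar (tensor_space J) Q"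
      "\<And>i. x i \<in> coord_space (J i)" for x
    \<comment> \<open>The two inclusions trade places when the bodies are replaced by their polars.\<close>
    using that
    by (intro minkowski_tensor[OF Q' Qs'])
       (simp_all add: bipolar[OF T Q] bipolar[OF subspace_coord_space Qs])
  then show ?thesis
    using minkowski_tensor[OF Q Qs]
    unfolding reasonable_crossnorm_minkowski_iff[OF Q Qs] inj by blast
qed

end
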